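(* Let $f,g\in\mathbb{R}[x,y]$ be nonzero polynomials with $f(0,0)=g(0,0)=0$ (here $g$ need not have an isolated zero at the origin). Assume that $$G_{f,g}:=y\left(g\frac{\partial f}{\partial x}-f\frac{\partial g}{\partial x}\right)-x\left(g\frac{\partial f}{\partial y}-f\frac{\partial g}{\partial y}\right)\equiv 0.$$ Then $$\lim_{(x,y)\to(0,0)}\frac{f(x,y)}{g(x,y)}=0\quad\text{if and only if}\quad\operatorname{ord} f>\operatorname{ord} g.$$
   Context: For a nonzero polynomial $f$, written as a sum of homogeneous components $f=f_m+f_{m+1}+\cdots$ with $f_m\not\equiv 0$ of lowest degree $m$, the order is $\operatorname{ord} f:=m$. The limit is taken over points $(x,y)\in\mathbb{R}^2$ with $g(x,y)\neq 0$. *)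

theory Defs
  imports "HOL-Analysis.Analysis" "HOL-Computational_Algebra.Polynomial"
begin

(* The ring R[x,y] is represented as R[x][y], i.e. by the type real poly poly: the outer
   indeterminate is y, the inner one is x, and the coefficient of x^i y^j in p is
   coeff (coeff p j) i. *)

definition var_x :: "real poly poly"
  where "var_x = [:[:0, 1:]:]"

definition var_y :: "real poly poly"
  where "var_y = [:0, 1:]"

definition eval_xy :: "real poly poly \<Rightarrow> real \<Rightarrow> real \<Rightarrow> real"
  where "eval_xy p a b = poly (poly p [:b:]) a"

definition deriv_x :: "real poly poly \<Rightarrow> real poly poly"
  where "deriv_x p = map_poly pderiv p"

definition deriv_y :: "real poly poly \<Rightarrow> real poly poly"
  where "deriv_y p = pderiv p"

definition hom_component :: "nat \<Rightarrow> real poly poly \<Rightarrow> real poly poly"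
  where "hom_component m p = (\<Sum>i\<le>m. monom (monom (coeff (coeff p (m - i)) i) i) (m - i))"

(* Only meaningful for p \<noteq> 0. *)
definition ord_xy :: "real poly poly \<Rightarrow> nat"
  where "ord_xy p = (LEAST m. hom_component m p \<noteq> 0)"

definition G_poly :: "real poly poly \<Rightarrow> real poly poly \<Rightarrow> real poly poly"
  where "G_poly f g =
    var_y * (g * deriv_x f - f * deriv_x g) - var_x * (g * deriv_y f - f * deriv_y g)"

lemma eval_xy_simps [simp]:
  "eval_xy var_x a b = a" "eval_xy var_y a b = b"
  "eval_xy (p + q) a b = eval_xy p a b + eval_xy q a b"
  "eval_xy (p * q) a b = eval_xy p a b * eval_xy q a b"
  "eval_xy (monom (monom c i) j) a b = c * a ^ i * b ^ j"
  by (simp_all add: eval_xy_def var_x_def var_y_def poly_monom mult_ac)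

lemma coeff_deriv_x:
  "coeff (coeff (deriv_x p) j) i = of_nat (Suc i) * coeff (coeff p j) (Suc i)"
  by (simp add: deriv_x_def coeff_map_poly coeff_pderiv)

lemma coeff_deriv_y:
  "coeff (coeff (deriv_y p) j) i = of_nat (Suc j) * coeff (coeff p (Suc j)) i"
  unfolding deriv_y_def coeff_pderiv of_nat_poly by simp

lemma coeff_hom_component:
  "coeff (coeff (hom_component m p) j) i = (if i + j = m then coeff (coeff p j) i else 0)"
proof -
  have "coeff (coeff (hom_component m p) j) i =
      (\<Sum>k\<le>m. if k = i then (if i \<le> m \<and> m - i = j then coeff (coeff p j) i else 0) else 0)"
    unfolding hom_component_def coeff_sum by (intro sum.cong) auto
  also have "\<dots> = (if i + j = m then coeff (coeff p j) i else 0)"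
    by auto
  finally show ?thesis .
qed

lemma hom_component_nonzero_iff:
  "hom_component m p \<noteq> 0 \<longleftrightarrow> (\<exists>i j. i + j = m \<and> coeff (coeff p j) i \<noteq> 0)"
  by (auto simp: poly_eq_iff coeff_hom_component)

end

theory Submission
  imports Defs
begin

text \<open>
  The derivation \<open>y \<partial>x - x \<partial>y\<close> generates the rotations, so the hypothesis makes \<open>f / g\<close> locally
  constant on every circle around the origin wherever \<open>g \<noteq> 0\<close>. Restricted to a circle, \<open>f\<close> and \<open>g\<close>
  are trigonometric polynomials, and one that vanishes on an arc vanishes on the whole circle; hence
  \<open>f / g\<close> depends only on the radius. The limit can therefore be computed along a single ray in a
  direction where both lowest homogeneous components are nonzero, on which \<open>f / g\<close> behaves like
  a nonzero constant times \<open>t\<close> to the power \<open>ord f - ord g\<close>.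
\<close>

subsection \<open>Homogeneous components and rays\<close>

lemma eval_xy_0 [simp]: "eval_xy 0 a b = 0"
  by (simp add: eval_xy_def)

lemma eval_xy_diff [simp]: "eval_xy (p - q) a b = eval_xy p a b - eval_xy q a b"
  by (simp add: eval_xy_def)

lemma eval_xy_sum: "eval_xy (\<Sum>i\<in>A. p i) a b = (\<Sum>i\<in>A. eval_xy (p i) a b)"
  by (induction A rule: infinite_finite_induct) auto

lemma eval_xy_pCons: "eval_xy (pCons q p) a b = poly q a + b * eval_xy p a b"
  by (simp add: eval_xy_def)

lemma continuous_on_eval_xy [continuous_intros]:
  assumes "continuous_on S u" "continuous_on S v"
  shows "continuous_on S (\<lambda>t. eval_xy p (u t) (v t))"
  by (induction p) (auto simp: eval_xy_pCons intro!: continuous_intros assms)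

text \<open>Over the integral domain of polynomials in \<open>x\<close>, a nonzero \<open>p\<close>
  has only finitely many roots, so some constant \<open>[:b:]\<close> is not one of them.
  Substituting it leaves a nonzero polynomial in \<open>x\<close>, which is nonzero at some
  \<open>a\<close>.\<close>

lemma eval_xy_nonzero_exists:
  assumes "p \<noteq> 0"
  obtains a b where "eval_xy p a b \<noteq> 0"
proof -
  have "finite {q. poly p q = 0}"
    using assms by (rule poly_roots_finite)
  moreover have "infinite (range (\<lambda>b::real. [:b:]))"
    by (subst finite_image_iff) (auto simp: inj_on_def infinite_UNIV_char_0)
  ultimately have "\<not> range (\<lambda>b::real. [:b:]) \<subseteq> {q. poly p q = 0}"
    using finite_subset by blast
  then obtain b where "poly p [:b:] \<noteq> 0"
    by auto
  then obtain a where "poly (poly p [:b:]) a \<noteq> 0"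
    using poly_all_0_iff_0 by blast
  then show thesis
    by (intro that) (simp add: eval_xy_def)
qed

lemma eval_xy_hom_component_scale:
  "eval_xy (hom_component k p) (t * a) (t * b) = t ^ k * eval_xy (hom_component k p) a b"
  by (auto simp: hom_component_def eval_xy_sum sum_distrib_left power_mult_distrib
      power_add [symmetric] intro!: sum.cong)

lemma sum_hom_components:
  obtains N where "p = (\<Sum>k\<le>N. hom_component k p)"
proof -
  \<comment> \<open>A crude bound on the total degree: \<open>i + j > N\<close> forces
    \<open>j > degree p\<close> or \<open>i > degree (coeff p j)\<close>.\<close>
  define N where "N = degree p + (\<Sum>j\<le>degree p. degree (coeff p j))"
  have high: "coeff (coeff p j) i = 0" if "i + j > N" for i j
  proof (cases "j \<le> degree p")
    case True
    then have "degree (coeff p j) \<le> (\<Sum>j\<le>degree p. degree (coeff p j))"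
      by (intro member_le_sum) auto
    then show ?thesis
      using True that by (intro coeff_eq_0) (auto simp: N_def)
  qed (simp add: coeff_eq_0)
  have "coeff (coeff p j) i = coeff (coeff (\<Sum>k\<le>N. hom_component k p) j) i" for i j
    using high[of i j] by (auto simp: coeff_sum coeff_hom_component not_le)
  then show thesis
    by (intro that[of N]) (auto simp: poly_eq_iff)
qed

lemma hom_component_ord_nonzero:
  assumes "p \<noteq> 0"
  shows "hom_component (ord_xy p) p \<noteq> 0"
proof -
  from assms obtain i j where "coeff (coeff p j) i \<noteq> 0"
    by (auto simp: poly_eq_iff)
  then have "\<exists>m. hom_component m p \<noteq> 0"
    by (auto simp: hom_component_nonzero_iff)
  then show ?thesis
    unfolding ord_xy_def by (rule LeastI_ex)
qed

lemma hom_component_below_ord: "k < ord_xy p \<Longrightarrow> hom_component k p = 0"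
  unfolding ord_xy_def using not_less_Least by blast

text \<open>On the ray the degree-\<open>k\<close> component contributes \<open>t ^ k\<close> times
  its value at \<open>(u, v)\<close>. Components below the order vanish, so
  \<open>t ^ ord_xy p\<close> factors out and the lowest component supplies the constant term of
  \<open>q\<close>.\<close>

lemma eval_xy_ray:
  obtains q where "\<And>t. eval_xy p (t * u) (t * v) = t ^ ord_xy p * poly q t"
    and "poly q 0 = eval_xy (hom_component (ord_xy p) p) u v"
proof -
  define m where "m = ord_xy p"
  define c where "c k = eval_xy (hom_component k p) u v" for k
  obtain N where N: "p = (\<Sum>k\<le>N. hom_component k p)"
    by (rule sum_hom_components)
  have c_below: "c k = 0" if "k < m" for k
    using that by (simp add: c_def m_def hom_component_below_ord)
  \<comment> \<open>All that is known of \<open>N\<close> is the decomposition itself; comparing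
    coefficients in it shows that no component lies above \<open>N\<close>.\<close>
  have c_above: "c k = 0" if "k > N" for k
  proof -
    have "hom_component k p = 0"
    proof (rule ccontr)
      assume "hom_component k p \<noteq> 0"
      then obtain i j where "i + j = k" "coeff (coeff p j) i \<noteq> 0"
        by (auto simp: hom_component_nonzero_iff)
      moreover have "coeff (coeff p j) i = (\<Sum>l\<le>N. if i + j = l then coeff (coeff p j) i else 0)"
        by (subst N) (simp add: coeff_sum coeff_hom_component)
      ultimately show False
        using that by auto
    qed
    then show ?thesis
      by (simp add: c_def)
  qed
  define q where "q = (\<Sum>k\<le>N. monom (c (m + k)) k)"
  have "eval_xy p (t * u) (t * v) = t ^ m * poly q t" for t
  proof -
    have "eval_xy p (t * u) (t * v) = (\<Sum>k\<le>N. t ^ k * c k)"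
      by (subst N) (simp add: eval_xy_sum eval_xy_hom_component_scale c_def)
    \<comment> \<open>The two index ranges differ only in degrees below \<open>m\<close> or above
      \<open>N\<close>, where \<open>c\<close> vanishes; \<open>m\<close> and \<open>N\<close> need
      not be compared.\<close>
    also have "\<dots> = (\<Sum>k\<in>{m..m + N}. t ^ k * c k)"
      by (rule sum.mono_neutral_cong) (auto simp: not_le intro: c_below c_above)
    also have "\<dots> = (\<Sum>k\<le>N. t ^ (m + k) * c (m + k))"
      by (rule sum.reindex_bij_witness[of _ "\<lambda>k. m + k" "\<lambda>k. k - m"]) auto
    also have "\<dots> = t ^ m * poly q t"
      by (simp add: q_def poly_sum poly_monom sum_distrib_left power_add mult_ac)
    finally show ?thesis .
  qed
  moreover have "poly q 0 = c m"
    by (simp add: q_def poly_sum poly_monom power_0_left if_distrib[of "\<lambda>x. _ * x"] cong: if_cong)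
  ultimately show thesis
    by (intro that) (simp_all add: m_def c_def)
qed

lemma ray_eventually_nonzero:
  assumes "\<And>t. eval_xy p (t * u) (t * v) = t ^ k * poly q t" and "poly q 0 \<noteq> 0"
  shows "\<forall>\<^sub>F t in at_right 0. eval_xy p (t * u) (t * v) \<noteq> 0"
proof -
  have "(poly q \<longlongrightarrow> poly q 0) (at_right 0)"
    by (intro tendsto_intros)
  then have "\<forall>\<^sub>F t in at_right 0. poly q t \<noteq> 0"
    using assms(2) by (rule tendsto_imp_eventually_ne)
  then show ?thesis
    using eventually_at_right_less[of 0] by eventually_elim (simp add: assms(1))
qed

subsection \<open>Restriction to circles\<close>

lemma eval_xy_has_real_derivative:
  assumes "(u has_real_derivative u') (at t)" "(v has_real_derivative v') (at t)"
  shows "((\<lambda>t. eval_xy p (u t) (v t)) has_real_derivative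
           eval_xy (deriv_x p) (u t) (v t) * u' + eval_xy (deriv_y p) (u t) (v t) * v') (at t)"
proof (induction p)
  case 0
  then show ?case
    by (simp add: deriv_x_def deriv_y_def)
next
  case (pCons q p)
  have dx: "deriv_x (pCons q p) = pCons (pderiv q) (deriv_x p)"
    using pCons.hyps by (auto simp: deriv_x_def map_poly_pCons)
  have dy: "deriv_y (pCons q p) = p + pCons 0 (deriv_y p)"
    by (simp add: deriv_y_def pderiv_pCons)
  have "((\<lambda>t. poly q (u t)) has_real_derivative poly (pderiv q) (u t) * u') (at t)"
    by (rule DERIV_chain2[OF poly_DERIV assms(1)])
  from DERIV_add[OF this DERIV_mult[OF assms(2) pCons.IH]] show ?case
    by (simp add: dx dy eval_xy_pCons algebra_simps)
qed

text \<open>Cosine and sine are Laurent polynomials in \<open>cis \<theta>\<close>, and a power of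
  \<open>cis \<theta>\<close> clears the negative exponents. The functions of this form, singled out
  by \<open>T\<close>, are closed under sums and products, so induction on \<open>p\<close>
  applies.\<close>

lemma eval_xy_circle_cis:
  "\<exists>n P. \<forall>\<theta>. cis \<theta> ^ n * complex_of_real (eval_xy p (r * cos \<theta>) (r * sin \<theta>)) = poly P (cis \<theta>)"
proof -
  define T where
    "T \<phi> \<longleftrightarrow> (\<exists>n P. \<forall>\<theta>. cis \<theta> ^ n * complex_of_real (\<phi> \<theta>) = poly P (cis \<theta>))" for \<phi> :: "real \<Rightarrow> real"
  have const: "T (\<lambda>_. c)" for c
    unfolding T_def by (intro exI[of _ 0] exI[of _ "[:of_real c:]"]) simp
  have add: "T (\<lambda>\<theta>. \<phi> \<theta> + \<psi> \<theta>)" and mult: "T (\<lambda>\<theta>. \<phi> \<theta> * \<psi> \<theta>)" if "T \<phi>" "T \<psi>" for \<phi> \<psi>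
  proof -
    from that obtain m P n Q
      where P: "\<And>\<theta>. cis \<theta> ^ m * complex_of_real (\<phi> \<theta>) = poly P (cis \<theta>)"
        and Q: "\<And>\<theta>. cis \<theta> ^ n * complex_of_real (\<psi> \<theta>) = poly Q (cis \<theta>)"
      unfolding T_def by blast
    \<comment> \<open>Both summands are brought to the common exponent \<open>m + n\<close>.\<close>
    show "T (\<lambda>\<theta>. \<phi> \<theta> + \<psi> \<theta>)"
      unfolding T_def
      by (intro exI[of _ "m + n"] exI[of _ "monom 1 n * P + monom 1 m * Q"])
        (simp add: P [symmetric] Q [symmetric] poly_monom power_add algebra_simps)
    show "T (\<lambda>\<theta>. \<phi> \<theta> * \<psi> \<theta>)"
      unfolding T_def
      by (intro exI[of _ "m + n"] exI[of _ "P * Q"])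
        (simp add: P [symmetric] Q [symmetric] power_add algebra_simps)
  qed
  \<comment> \<open>Euler's formulas, multiplied by \<open>cis \<theta>\<close> to remove its
    inverse.\<close>
  have cis: "cis \<theta> * complex_of_real (cos \<theta>) = (1 + cis \<theta> * cis \<theta>) / 2"
    "cis \<theta> * complex_of_real (sin \<theta>) = (1 - cis \<theta> * cis \<theta>) * \<i> / 2" for \<theta>
    using sin_cos_squared_add[of \<theta>]
    by (auto simp: complex_eq_iff power2_eq_square algebra_simps)
  have "T cos"
    unfolding T_def
    by (intro exI[of _ 1] exI[of _ "[:1/2, 0, 1/2:]"]) (simp add: cis field_simps)
  then have x: "T (\<lambda>\<theta>. r * cos \<theta>)"
    by (intro mult const)
  have "T sin"
    unfolding T_def
    by (intro exI[of _ 1] exI[of _ "[:\<i>/2, 0, -\<i>/2:]"]) (simp add: cis field_simps)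
  then have y: "T (\<lambda>\<theta>. r * sin \<theta>)"
    by (intro mult const)
  have poly: "T (\<lambda>\<theta>. poly q (r * cos \<theta>))" for q
    by (induction q) (simp_all add: const add mult x)
  have "T (\<lambda>\<theta>. eval_xy p (r * cos \<theta>) (r * sin \<theta>))"
    by (induction p) (simp_all add: const eval_xy_pCons add mult y poly)
  then show "\<exists>n P. \<forall>\<theta>. cis \<theta> ^ n * complex_of_real (eval_xy p (r * cos \<theta>) (r * sin \<theta>)) = poly P (cis \<theta>)"
    by (simp add: T_def)
qed

lemma inj_on_cis: "inj_on cis {s - pi<..<s + pi}"
proof (rule inj_onI)
  fix x y assume *: "x \<in> {s - pi<..<s + pi}" "y \<in> {s - pi<..<s + pi}" "cis x = cis y"
  have "cis (x - y) = 1"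
    using *(3) by (simp add: cis_divide [symmetric])
  then have "cos (x - y) = 1"
    by (simp add: complex_eq_iff)
  then obtain n :: int where n: "x - y = n * 2 * pi"
    unfolding cos_one_2pi_int by (auto simp: mult.assoc)
  have "\<bar>x - y\<bar> < 2 * pi"
    using * by auto
  then have "\<bar>real_of_int n\<bar> < 1"
    using pi_gt_zero by (simp add: n abs_mult)
  then have "n = 0"
    by linarith
  then show "x = y"
    using n by simp
qed

text \<open>Up to a power of \<open>cis \<theta>\<close>, the difference \<open>f - c * g\<close> on
  the circle is a polynomial in \<open>cis \<theta>\<close>. The arc gives that polynomial
  infinitely many roots, so it is zero, and the nonzero power can be cancelled at every
  angle.\<close>

lemma eval_xy_circle_identity:
  assumes "\<alpha> < \<beta>"
    and "\<And>\<theta>. \<theta> \<in> {\<alpha><..<\<beta>} \<Longrightarrow> eval_xy f (r * cos \<theta>) (r * sin \<theta>) = c * eval_xy g (r * cos \<theta>) (r * sin \<theta>)"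
  shows "eval_xy f (r * cos \<theta>) (r * sin \<theta>) = c * eval_xy g (r * cos \<theta>) (r * sin \<theta>)"
proof -
  define h where "h = f - [:[:c:]:] * g"
  have h: "eval_xy h a b = eval_xy f a b - c * eval_xy g a b" for a b
    by (simp add: h_def eval_xy_def)
  obtain n P where P: "\<And>\<theta>. cis \<theta> ^ n * complex_of_real (eval_xy h (r * cos \<theta>) (r * sin \<theta>)) = poly P (cis \<theta>)"
    using eval_xy_circle_cis[of h r] by blast
  \<comment> \<open>Cutting the arc at \<open>\<alpha> + pi\<close> keeps it in a window where
    \<open>cis\<close> is injective, so its image remains infinite.\<close>
  define A where "A = {\<alpha><..<min \<beta> (\<alpha> + pi)}"
  have "infinite A"
    using assms(1) pi_gt_zero by (auto simp: A_def infinite_Ioo)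
  moreover have "inj_on cis A"
    by (rule inj_on_subset[OF inj_on_cis[of \<alpha>]]) (auto simp: A_def)
  ultimately have "infinite (cis ` A)"
    by (simp add: finite_image_iff)
  moreover have "cis ` A \<subseteq> {z. poly P z = 0}"
    using assms(2) by (auto simp: P [symmetric] h A_def)
  ultimately have "P = 0"
    using finite_subset poly_roots_finite by blast
  then show ?thesis
    using P[of \<theta>] by (simp add: h flip: of_real_mult)
qed

text \<open>The quotient is constant on an arc around the base point, and the circle identity
  spreads the proportionality to the whole circle. The product form passes through zeros of
  \<open>g\<close>, where constancy of the quotient alone would stop.\<close>

lemma G_poly_zero_proportional_on_circle:
  assumes "G_poly f g = 0" and "eval_xy g a\<^sub>0 b\<^sub>0 \<noteq> 0" and "a\<^sup>2 + b\<^sup>2 = a\<^sub>0\<^sup>2 + b\<^sub>0\<^sup>2"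
  shows "eval_xy f a b = eval_xy f a\<^sub>0 b\<^sub>0 / eval_xy g a\<^sub>0 b\<^sub>0 * eval_xy g a b"
proof -
  define r where "r = sqrt (a\<^sub>0\<^sup>2 + b\<^sub>0\<^sup>2)"
  define F where "F = (\<lambda>\<theta>. eval_xy f (r * cos \<theta>) (r * sin \<theta>))"
  define H where "H = (\<lambda>\<theta>. eval_xy g (r * cos \<theta>) (r * sin \<theta>))"
  have polar: "\<exists>\<theta>. x = r * cos \<theta> \<and> y = r * sin \<theta>" if "x\<^sup>2 + y\<^sup>2 = r\<^sup>2" for x y
  proof -
    have "norm (Complex x y) = r"
      using that by (simp add: cmod_def r_def)
    then have "Complex x y = rcis r (Arg (Complex x y))"
      using rcis_cmod_Arg by metis
    then show ?thesis
      by (metis Re_rcis Im_rcis complex.sel)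
  qed
  have r2: "r\<^sup>2 = a\<^sub>0\<^sup>2 + b\<^sub>0\<^sup>2"
    by (simp add: r_def)
  obtain \<theta>\<^sub>0 where \<theta>\<^sub>0: "a\<^sub>0 = r * cos \<theta>\<^sub>0" "b\<^sub>0 = r * sin \<theta>\<^sub>0"
    using polar[of a\<^sub>0 b\<^sub>0] r2 by auto
  obtain \<theta> where \<theta>: "a = r * cos \<theta>" "b = r * sin \<theta>"
    using polar[of a b] r2 assms(3) by auto
  have deriv: "((\<lambda>\<theta>. F \<theta> / H \<theta>) has_real_derivative 0) (at \<theta>)" if "H \<theta> \<noteq> 0" for \<theta>
  proof -
    define x where "x = r * cos \<theta>"
    define y where "y = r * sin \<theta>"
    have cs: "((\<lambda>\<theta>. r * cos \<theta>) has_real_derivative - y) (at \<theta>)"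
      "((\<lambda>\<theta>. r * sin \<theta>) has_real_derivative x) (at \<theta>)"
      by (auto simp: x_def y_def intro!: derivative_eq_intros)
    \<comment> \<open>The point \<open>(x, y)\<close> moves with velocity \<open>(- y, x)\<close>,
      so the numerator of the quotient rule is minus the value of \<open>G_poly f g\<close>.\<close>
    have "eval_xy (G_poly f g) x y = 0"
      by (simp add: assms(1))
    then have "(eval_xy (deriv_x f) x y * - y + eval_xy (deriv_y f) x y * x) * H \<theta> -
        F \<theta> * (eval_xy (deriv_x g) x y * - y + eval_xy (deriv_y g) x y * x) = 0"
      by (simp add: G_poly_def F_def H_def x_def [symmetric] y_def [symmetric] algebra_simps)
    then show ?thesis
      using DERIV_divide[OF eval_xy_has_real_derivative[OF cs, of f]
          eval_xy_has_real_derivative[OF cs, of g]] that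
      by (simp add: F_def H_def x_def y_def)
  qed
  have "H \<theta>\<^sub>0 \<noteq> 0"
    using assms(2) by (simp add: H_def \<theta>\<^sub>0)
  moreover have "continuous_on UNIV H"
    unfolding H_def by (intro continuous_intros)
  ultimately obtain e where "e > 0" and e: "\<And>t. dist \<theta>\<^sub>0 t < e \<Longrightarrow> H t \<noteq> 0"
    using continuous_on_open_avoid[of UNIV H \<theta>\<^sub>0 0] by auto
  have ne: "H t \<noteq> 0" if "t \<in> {\<theta>\<^sub>0 - e<..<\<theta>\<^sub>0 + e}" for t
    using that by (intro e) (auto simp: dist_real_def)
  have "\<exists>c. \<forall>t\<in>{\<theta>\<^sub>0 - e<..<\<theta>\<^sub>0 + e}. F t / H t = c"
    by (rule has_field_derivative_zero_constant)
      (auto intro!: has_field_derivative_at_within deriv ne)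
  then obtain c where c: "\<And>t. t \<in> {\<theta>\<^sub>0 - e<..<\<theta>\<^sub>0 + e} \<Longrightarrow> F t / H t = c"
    by blast
  have *: "F t = c * H t" if "t \<in> {\<theta>\<^sub>0 - e<..<\<theta>\<^sub>0 + e}" for t
    using c[OF that] ne[OF that] by (simp add: field_simps)
  have "\<theta>\<^sub>0 - e < \<theta>\<^sub>0 + e"
    using \<open>e > 0\<close> by simp
  from eval_xy_circle_identity[OF this * [unfolded F_def H_def]]
  have "F \<theta> = c * H \<theta>"
    unfolding F_def H_def .
  moreover have "c = F \<theta>\<^sub>0 / H \<theta>\<^sub>0"
    using c[of \<theta>\<^sub>0] \<open>e > 0\<close> by simp
  ultimately show ?thesis
    by (simp add: F_def H_def \<theta> \<theta>\<^sub>0)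
qed

section \<open>Comparing the planar limit with the limit along one ray\<close>

theorem theorem4p11:
  fixes f g :: "real poly poly"
  assumes "f \<noteq> 0" and "g \<noteq> 0"
    and "eval_xy f 0 0 = 0" and "eval_xy g 0 0 = 0"
    and "G_poly f g = 0"
  shows "((\<lambda>(a, b). eval_xy f a b / eval_xy g a b) \<longlongrightarrow> 0)
           (at (0, 0) within {(a, b). eval_xy g a b \<noteq> 0})
         \<longleftrightarrow> ord_xy f > ord_xy g"
proof -
  define m where "m = ord_xy f"
  define n where "n = ord_xy g"
  have "var_x \<noteq> 0"
    by (simp add: var_x_def)
  \<comment> \<open>One point where this product is nonzero serves both lowest components; the
    factor \<open>var_x\<close> forces \<open>u \<noteq> 0\<close>, so that \<open>(u, v)\<close> is
    a genuine direction.\<close>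
  then have "hom_component m f * hom_component n g * var_x \<noteq> 0"
    using assms(1,2) by (simp add: m_def n_def hom_component_ord_nonzero)
  then obtain u v where "eval_xy (hom_component m f * hom_component n g * var_x) u v \<noteq> 0"
    by (rule eval_xy_nonzero_exists)
  then have uv: "eval_xy (hom_component m f) u v \<noteq> 0" "eval_xy (hom_component n g) u v \<noteq> 0" "u \<noteq> 0"
    by auto
  obtain P where P: "\<And>t. eval_xy f (t * u) (t * v) = t ^ m * poly P t" and P0: "poly P 0 \<noteq> 0"
    using eval_xy_ray[of f u v] uv(1) unfolding m_def by metis
  obtain Q where Q: "\<And>t. eval_xy g (t * u) (t * v) = t ^ n * poly Q t" and Q0: "poly Q 0 \<noteq> 0"
    using eval_xy_ray[of g u v] uv(2) unfolding n_def by metis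
  define \<phi> where "\<phi> t = eval_xy f (t * u) (t * v) / eval_xy g (t * u) (t * v)" for t
  have g_ne: "\<forall>\<^sub>F t in at_right 0. eval_xy g (t * u) (t * v) \<noteq> 0"
    using Q Q0 by (rule ray_eventually_nonzero)
  have PQ: "((\<lambda>t. poly P t / poly Q t) \<longlongrightarrow> poly P 0 / poly Q 0) (at_right 0)"
    using Q0 by (intro tendsto_intros)
  let ?q = "\<lambda>(a, b). eval_xy f a b / eval_xy g a b"
  let ?F = "at (0, 0) within {(a, b). eval_xy g a b \<noteq> 0}"
  show ?thesis
  proof
    assume lim: "(?q \<longlongrightarrow> 0) ?F"
    \<comment> \<open>The ray tends to the origin through admissible points, so the planar limit
      restricts to it.\<close>
    have "filterlim (\<lambda>t. (t * u, t * v)) ?F (at_right 0)"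
      unfolding filterlim_at
    proof (intro conjI)
      show "\<forall>\<^sub>F t in at_right 0. (t * u, t * v) \<in> {(a, b). eval_xy g a b \<noteq> 0} \<and> (t * u, t * v) \<noteq> (0, 0)"
        using g_ne eventually_at_right_less[of 0] by eventually_elim (use uv(3) in auto)
      show "((\<lambda>t. (t * u, t * v)) \<longlongrightarrow> (0, 0)) (at_right 0)"
        by (auto intro!: tendsto_eq_intros)
    qed
    from filterlim_compose[OF lim this] have \<phi>: "(\<phi> \<longlongrightarrow> 0) (at_right 0)"
      by (simp add: \<phi>_def [abs_def])
    show "ord_xy f > ord_xy g"
    proof (rule ccontr)
      assume "\<not> ord_xy f > ord_xy g"
      then have mn: "m \<le> n"
        by (simp add: m_def n_def)
      \<comment> \<open>For \<open>m \<le> n\<close> the factor \<open>t ^ (n - m)\<close> cancels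
        the negative power in \<open>\<phi>\<close>, leaving a quotient with nonzero limit. The left
        side still tends to 0 when \<open>m = n\<close>, since \<open>\<phi>\<close> itself
        does.\<close>
      have "((\<lambda>t. t ^ (n - m) * \<phi> t) \<longlongrightarrow> 0 ^ (n - m) * 0) (at_right 0)"
        by (intro tendsto_intros \<phi>)
      moreover have "\<forall>\<^sub>F t in at_right 0. t ^ (n - m) * \<phi> t = poly P t / poly Q t"
        using eventually_at_right_less[of 0]
      proof eventually_elim
        case (elim t)
        have "t ^ n = t ^ (n - m) * t ^ m"
          using mn by (simp flip: power_add)
        then show ?case
          using elim by (simp add: \<phi>_def P Q)
      qed
      ultimately have "((\<lambda>t. poly P t / poly Q t) \<longlongrightarrow> 0) (at_right 0)"
        unfolding mult_zero_right by (rule Lim_transform_eventually)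
      then have "poly P 0 / poly Q 0 = 0"
        using PQ by (intro tendsto_unique[of "at_right 0"]) auto
      then show False
        using P0 Q0 by simp
    qed
  next
    assume "ord_xy f > ord_xy g"
    then have mn: "m > n"
      by (simp add: m_def n_def)
    have "((\<lambda>t. t ^ (m - n) * (poly P t / poly Q t)) \<longlongrightarrow> 0 ^ (m - n) * (poly P 0 / poly Q 0)) (at_right 0)"
      by (intro tendsto_intros PQ)
    moreover have "\<forall>\<^sub>F t in at_right 0. t ^ (m - n) * (poly P t / poly Q t) = \<phi> t"
      using eventually_at_right_less[of 0]
    proof eventually_elim
      case (elim t)
      have "t ^ m = t ^ (m - n) * t ^ n"
        using mn by (simp flip: power_add)
      then show ?case
        using elim by (simp add: \<phi>_def P Q)
    qed
    ultimately have "(\<phi> \<longlongrightarrow> 0 ^ (m - n) * (poly P 0 / poly Q 0)) (at_right 0)"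
      by (rule Lim_transform_eventually)
    then have \<phi>: "(\<phi> \<longlongrightarrow> 0) (at_right 0)"
      using mn by (simp add: power_0_left)
    \<comment> \<open>\<open>\<rho> z\<close> is the parameter at which the ray meets the circle
      through \<open>z\<close>, so the planar quotient should equal
      \<open>\<phi> (\<rho> z)\<close>.\<close>
    define \<rho> :: "real \<times> real \<Rightarrow> real" where "\<rho> z = norm z / norm (u, v)" for z
    have uv_pos: "norm (u, v) > 0"
      using uv(3) by (simp add: zero_prod_def)
    have \<rho>: "filterlim \<rho> (at_right 0) ?F"
      unfolding filterlim_at
    proof (intro conjI)
      show "\<forall>\<^sub>F z in ?F. \<rho> z \<in> {0<..} \<and> \<rho> z \<noteq> 0"
        using uv_pos by (auto simp: eventually_at_filter \<rho>_def zero_prod_def)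
      show "(\<rho> \<longlongrightarrow> 0) ?F"
        unfolding \<rho>_def [abs_def] using uv_pos
        by (auto intro!: tendsto_eq_intros simp: zero_prod_def)
    qed
    have "((\<lambda>z. \<phi> (\<rho> z)) \<longlongrightarrow> 0) ?F"
      by (rule filterlim_compose[OF \<phi> \<rho>])
    moreover have "\<forall>\<^sub>F z in ?F. \<phi> (\<rho> z) = ?q z"
    proof -
      \<comment> \<open>The ray point is to be the base point of the proportionality on the circle,
        so \<open>g\<close> must be nonzero there; this holds for all small radii.\<close>
      have "\<forall>\<^sub>F z in ?F. eval_xy g (\<rho> z * u) (\<rho> z * v) \<noteq> 0"
        by (rule eventually_compose_filterlim[OF g_ne \<rho>])
      moreover have "\<forall>\<^sub>F z in ?F. z \<in> {(a, b). eval_xy g a b \<noteq> 0}"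
        by (simp add: eventually_at_filter)
      ultimately show ?thesis
      proof eventually_elim
        case (elim z)
        obtain a b where z: "z = (a, b)"
          by force
        have "(\<rho> z)\<^sup>2 * (u\<^sup>2 + v\<^sup>2) = a\<^sup>2 + b\<^sup>2"
          using uv(3) by (simp add: \<rho>_def z norm_Pair power_divide sum_power2_eq_zero_iff)
        then have "a\<^sup>2 + b\<^sup>2 = (\<rho> z * u)\<^sup>2 + (\<rho> z * v)\<^sup>2"
          by (simp add: algebra_simps)
        from G_poly_zero_proportional_on_circle[OF assms(5) elim(1) this] show ?case
          using elim(2) by (simp add: z \<phi>_def)
      qed
    qed
    ultimately show "(?q \<longlongrightarrow> 0) ?F"
      by (rule Lim_transform_eventually)
  qed
qed

end
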